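(* For every natural number $r\in\{1,2,3,\dots\}$, $$\sum_{n=1}^{\infty}\frac{1}{4^n\alpha^{rn}L^n_r}\binom{2n}{n}H_n = \frac{2\sqrt{\alpha^r L_r}}{\sqrt{\alpha^rL_r-1}}\ln \left(\frac{\sqrt{\alpha^r L_r}+\sqrt{\alpha^rL_r-1}}{2\sqrt{\alpha^rL_r-1}}\right).$$
   Context: $H_n=\sum_{k=1}^n \frac1k$ is the $n$-th harmonic number. $\alpha=\frac{1+\sqrt5}{2}$ is the golden ratio. $L_n$ is the $n$-th Lucas number: $L_0=2$, $L_1=1$, $L_n=L_{n-1}+L_{n-2}$ for $n\ge2$. $L_r^n$ means $(L_r)^n$. *)

theory Defs
  imports "HOL-Analysis.Harmonic_Numbers"
begin

fun lucas :: "nat \<Rightarrow> nat" where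
  "lucas 0 = 2"
| "lucas (Suc 0) = 1"
| "lucas (Suc (Suc n)) = lucas (Suc n) + lucas n"

definition golden_ratio :: real where
  "golden_ratio = (1 + sqrt 5) / 2"

end

theory Submission
  imports Defs "HOL-Analysis.Generalised_Binomial_Theorem"
begin

text \<open>
  The golden ratio and the Lucas number enter only through the product
  \<open>x = \<alpha>\<^sup>r L\<^sub>r\<close>, which exceeds \<open>1\<close> because \<open>\<alpha> > 1\<close> and \<open>L\<^sub>r \<ge> 1\<close>. With \<open>t = 1 / x\<close> the claim is the value at \<open>t\<close> of the generating function
  \<open>F(t) = \<Sum>n. C(2n, n) H\<^sub>n (t/4)\<^sup>n\<close>, which is \<open>(2/s) ln ((1 + s) / (2s))\<close> for
  \<open>s = \<surd>(1 - t)\<close> and \<open>\<bar>t\<bar> < 1\<close>.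

  Put \<open>c\<^sub>n = C(2n, n) / 4\<^sup>n\<close>. From \<open>(n + 1) c\<^sub>n\<^sub>+\<^sub>1 = (n + 1/2) c\<^sub>n\<close> and
  \<open>H\<^sub>n\<^sub>+\<^sub>1 = H\<^sub>n + 1/(n + 1)\<close>, the coefficients \<open>a\<^sub>n = c\<^sub>n H\<^sub>n\<close> satisfy
  \<open>(n + 1) a\<^sub>n\<^sub>+\<^sub>1 = (n + 1/2) a\<^sub>n + c\<^sub>n\<^sub>+\<^sub>1\<close>. For \<open>F\<close> this is the linear differential equation
  \<open>(1 - t) F' = F / 2 + K\<close> (\<open>central_harmonic_gf_ode\<close>), where \<open>K(t) = \<Sum>n. c\<^sub>n\<^sub>+\<^sub>1 t\<^sup>n\<close>. The binomial series
  \<open>\<Sum>n. c\<^sub>n t\<^sup>n = 1 / s\<close> gives \<open>K = (1/s - 1) / t = 1 / (s (1 + s))\<close>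
  (\<open>central_binomial_ratio_shifted_sums\<close>). Since \<open>s' = - 1 / (2s)\<close>,
  the integrating factor \<open>s\<close> turns the equation into \<open>(s F)' = K / s = 1 / (s\<^sup>2 (1 + s))\<close>,
  which is also the derivative of \<open>2 ln ((1 + s) / (2s))\<close>; both functions vanish at \<open>t = 0\<close>
  (\<open>central_harmonic_gf_eq\<close>).
\<close>

section \<open>Normalised central binomial coefficients\<close>

definition central_binomial_ratio :: "nat \<Rightarrow> real" where
  "central_binomial_ratio n = real ((2 * n) choose n) / 4 ^ n"

lemma central_binomial_ratio_0 [simp]: "central_binomial_ratio 0 = 1"
  by (simp add: central_binomial_ratio_def)

lemma central_binomial_Suc:
  "Suc n * ((2 * Suc n) choose Suc n) = 2 * (2 * n + 1) * ((2 * n) choose n)"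
proof -
  have "Suc n * ((2 * Suc n) choose Suc n) = 2 * (Suc n * (Suc (2 * n) choose n))"
    using Suc_times_binomial[of n "Suc (2 * n)"] by (simp del: binomial_Suc_Suc)
  also have "Suc (2 * n) choose n = Suc (2 * n) choose Suc n"
    using binomial_symmetric[of n "Suc (2 * n)"] by (simp del: binomial_Suc_Suc)
  also have "Suc n * \<dots> = Suc (2 * n) * ((2 * n) choose n)"
    by (rule Suc_times_binomial)
  finally show ?thesis by simp
qed

lemma central_binomial_ratio_Suc:
  "real (Suc n) * central_binomial_ratio (Suc n) = (real n + 1 / 2) * central_binomial_ratio n"
proof -
  have "real (Suc n) * real ((2 * Suc n) choose Suc n)
          = 2 * (2 * real n + 1) * real ((2 * n) choose n)"
    using arg_cong[OF central_binomial_Suc[of n], of real]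
    by (simp only: of_nat_mult of_nat_add of_nat_numeral of_nat_1)
  then show ?thesis
    unfolding central_binomial_ratio_def by (simp add: field_simps del: of_nat_Suc binomial_Suc_Suc)
qed

lemma central_binomial_ratio_bounds:
  "0 \<le> central_binomial_ratio n" "central_binomial_ratio n \<le> 1"
proof -
  have "(2 * n) choose n \<le> 4 ^ n"
    using binomial_le_pow2[of "2 * n" n] by (simp add: power_mult)
  then have "real ((2 * n) choose n) \<le> 4 ^ n"
    by (metis of_nat_le_iff of_nat_numeral of_nat_power)
  then show "central_binomial_ratio n \<le> 1"
    by (simp add: central_binomial_ratio_def)
qed (simp add: central_binomial_ratio_def)

text \<open>
  Both sides satisfy the same first-order recurrence. This makes the generating function of the
  ratios the binomial series of \<open>(1 + z)\<close> to the power \<open>-1/2\<close> at \<open>z = -t\<close>.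
\<close>

lemma central_binomial_ratio_gbinomial:
  "central_binomial_ratio n = (-1) ^ n * ((-1/2) gchoose n)"
proof (induction n)
  case (Suc n)
  have "real (Suc n) * ((-1/2) gchoose Suc n) = - (real n + 1/2) * ((-1/2 :: real) gchoose n)"
    using gbinomial_mult_1[of "-1/2 :: real" n] by (simp add: algebra_simps)
  then have "real (Suc n) * ((-1) ^ Suc n * ((-1/2) gchoose Suc n))
      = (-1) ^ Suc n * (- (real n + 1/2) * ((-1/2) gchoose n))"
    by (metis mult.left_commute)
  also have "\<dots> = (real n + 1/2) * ((-1) ^ n * ((-1/2) gchoose n))"
    by (simp add: algebra_simps)
  also have "\<dots> = real (Suc n) * central_binomial_ratio (Suc n)"
    by (simp only: Suc central_binomial_ratio_Suc)
  finally show ?case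
    by (simp only: mult_cancel_left of_nat_eq_0_iff) simp
qed simp

lemma central_binomial_ratio_sums:
  fixes t :: real
  assumes "\<bar>t\<bar> < 1"
  shows "(\<lambda>n. central_binomial_ratio n * t ^ n) sums (1 / sqrt (1 - t))"
proof -
  have "(\<lambda>n. ((-1/2) gchoose n) * (-t) ^ n) sums (1 + (-t)) powr (-1/2)"
    by (rule gen_binomial_real) (use assms in simp)
  moreover have "((-1/2) gchoose n) * (-t) ^ n = central_binomial_ratio n * t ^ n" for n
    by (simp add: central_binomial_ratio_gbinomial power_minus[of t])
  moreover have "(1 + (-t)) powr (-1/2) = 1 / sqrt (1 - t)"
    using assms by (simp add: powr_minus_divide powr_half_sqrt)
  ultimately show ?thesis by simp
qed

text \<open>
  Dropping the constant term and dividing by \<open>t\<close> gives \<open>(1/s - 1) / t\<close> with \<open>s = \<surd>(1 - t)\<close>.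
  Because \<open>t = (1 - s) (1 + s)\<close>, this is the expression below, which also covers \<open>t = 0\<close>.
\<close>

lemma central_binomial_ratio_shifted_sums:
  fixes t :: real
  assumes "\<bar>t\<bar> < 1"
  shows "(\<lambda>n. central_binomial_ratio (Suc n) * t ^ n)
           sums (1 / (sqrt (1 - t) * (1 + sqrt (1 - t))))"
proof (cases "t = 0")
  case True
  have "central_binomial_ratio (Suc 0) = 1 / 2"
    by (simp add: central_binomial_ratio_def)
  then show ?thesis
    using powser_sums_zero[of "\<lambda>n. central_binomial_ratio (Suc n)"] True by simp
next
  case False
  define s where "s = sqrt (1 - t)"
  have s: "s > 0" "t = (1 - s) * (1 + s)"
    using assms by (auto simp: s_def algebra_simps)
  have "(\<lambda>n. central_binomial_ratio (Suc n) * t ^ Suc n) sums (1 / s - 1)"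
    using central_binomial_ratio_sums[OF assms]
      sums_Suc_iff[of "\<lambda>n. central_binomial_ratio n * t ^ n" "1 / s - 1"]
    by (simp add: s_def)
  then have "(\<lambda>n. central_binomial_ratio (Suc n) * t ^ Suc n / t) sums ((1 / s - 1) / t)"
    by (rule sums_divide)
  moreover have "(1 / s - 1) / t = 1 / (s * (1 + s))"
  proof -
    have "s \<noteq> 1" using s False by auto
    then show ?thesis using s(1) unfolding s(2) by (simp add: divide_simps)
  qed
  ultimately show ?thesis using False by (simp add: s_def)
qed

section \<open>The harmonic generating function\<close>

definition central_harmonic :: "nat \<Rightarrow> real" where
  "central_harmonic n = central_binomial_ratio n * harm n"

lemma central_harmonic_Suc:
  "real (Suc n) * central_harmonic (Suc n)
     = (real n + 1 / 2) * central_harmonic n + central_binomial_ratio (Suc n)"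
proof -
  have "real (Suc n) * central_harmonic (Suc n)
      = (real (Suc n) * central_binomial_ratio (Suc n)) * harm n + central_binomial_ratio (Suc n)"
    by (simp add: central_harmonic_def harm_Suc field_simps)
  then show ?thesis
    unfolding central_binomial_ratio_Suc by (simp add: central_harmonic_def)
qed

lemma harm_le: "harm n \<le> real n"
proof (induction n)
  case (Suc n)
  have "inverse (real (Suc n)) \<le> 1" by (simp add: inverse_le_1_iff)
  with Suc show ?case by (simp add: harm_Suc)
qed (simp add: harm_expand)

text \<open>
  A crude bound is enough here: it gives the power series a majorant \<open>\<Sum>n. (n + 1) \<bar>t\<bar>\<^sup>n\<close> on the whole
  open unit interval.
\<close>

lemma central_harmonic_bound: "\<bar>central_harmonic n\<bar> \<le> real (Suc n)"
proof -
  have "central_harmonic n \<le> 1 * real n"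
    unfolding central_harmonic_def
    by (intro mult_mono central_binomial_ratio_bounds harm_le harm_nonneg) simp
  moreover have "0 \<le> central_harmonic n"
    by (simp add: central_harmonic_def central_binomial_ratio_bounds harm_nonneg)
  ultimately show ?thesis by simp
qed

lemma summable_central_harmonic:
  fixes t :: real
  assumes "\<bar>t\<bar> < 1"
  shows "summable (\<lambda>n. central_harmonic n * t ^ n)"
proof (rule summable_comparison_test')
  show "summable (\<lambda>n. real (Suc n) * \<bar>t\<bar> ^ n)"
    using geometric_deriv_sums[of "\<bar>t\<bar>"] assms by (auto simp: sums_iff)
  show "norm (central_harmonic n * t ^ n) \<le> real (Suc n) * \<bar>t\<bar> ^ n" for n
    using central_harmonic_bound[of n] by (auto simp: abs_mult power_abs intro: mult_right_mono)
qed

definition central_harmonic_gf :: "real \<Rightarrow> real" where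
  "central_harmonic_gf t = (\<Sum>n. central_harmonic n * t ^ n)"

lemma central_harmonic_gf_0: "central_harmonic_gf 0 = 0"
  using powser_zero[of central_harmonic]
  by (simp add: central_harmonic_gf_def central_harmonic_def harm_expand)

text \<open>
  The coefficient recurrence, multiplied by \<open>t\<^sup>n\<close> and summed: the term \<open>n a\<^sub>n t\<^sup>n\<close> contributes
  \<open>t F'(t)\<close>, whence the factor \<open>1 - t\<close>.
\<close>

lemma central_harmonic_gf_ode:
  fixes t :: real
  assumes "\<bar>t\<bar> < 1"
  obtains D where "(central_harmonic_gf has_real_derivative D) (at t)"
    and "(1 - t) * D
           = central_harmonic_gf t / 2 + 1 / (sqrt (1 - t) * (1 + sqrt (1 - t)))"
proof
  define D where "D = (\<Sum>n. diffs central_harmonic n * t ^ n)"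
  show "(central_harmonic_gf has_real_derivative D) (at t)"
    unfolding central_harmonic_gf_def D_def
    by (rule termdiffs_strong'[where K = 1]) (use assms summable_central_harmonic in auto)
  have summable_D: "summable (\<lambda>n. diffs central_harmonic n * t ^ n)"
    by (rule termdiff_converges[where K = 1]) (use assms summable_central_harmonic in auto)
  have "(\<lambda>n. t * (real n * central_harmonic n * t ^ (n - Suc 0))) sums (t * D)"
    unfolding D_def by (intro sums_mult diffs_equiv summable_D)
  also have "(\<lambda>n. t * (real n * central_harmonic n * t ^ (n - Suc 0)))
      = (\<lambda>n. real n * central_harmonic n * t ^ n)"
  proof
    show "t * (real n * central_harmonic n * t ^ (n - Suc 0))
        = real n * central_harmonic n * t ^ n" for n
      by (cases n) auto
  qed
  finally have "(\<lambda>n. real n * central_harmonic n * t ^ n + central_harmonic n * t ^ n / 2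
          + central_binomial_ratio (Suc n) * t ^ n)
        sums (t * D + central_harmonic_gf t / 2 + 1 / (sqrt (1 - t) * (1 + sqrt (1 - t))))"
    unfolding central_harmonic_gf_def
    by (intro sums_add sums_divide summable_sums summable_central_harmonic assms
          central_binomial_ratio_shifted_sums)
  moreover have "real n * central_harmonic n * t ^ n + central_harmonic n * t ^ n / 2
      + central_binomial_ratio (Suc n) * t ^ n = diffs central_harmonic n * t ^ n" for n
    unfolding diffs_def of_nat_Suc[symmetric] central_harmonic_Suc
    by (simp add: algebra_simps)
  moreover have "(\<lambda>n. diffs central_harmonic n * t ^ n) sums D"
    unfolding D_def by (rule summable_sums[OF summable_D])
  ultimately have "D = t * D + central_harmonic_gf t / 2
      + 1 / (sqrt (1 - t) * (1 + sqrt (1 - t)))"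
    using sums_unique2 by simp
  then show "(1 - t) * D
      = central_harmonic_gf t / 2 + 1 / (sqrt (1 - t) * (1 + sqrt (1 - t)))"
    by (simp add: algebra_simps)
qed

text \<open>
  The equation is solved with the integrating factor \<open>\<surd>(1 - t)\<close>: the function \<open>\<Phi>\<close> below is the
  difference of the two antiderivatives and hence constant on the unit interval.
\<close>

lemma central_harmonic_gf_eq:
  fixes t :: real
  assumes "\<bar>t\<bar> < 1"
  shows "central_harmonic_gf t
           = 2 / sqrt (1 - t) * ln ((1 + sqrt (1 - t)) / (2 * sqrt (1 - t)))"
proof -
  define \<Phi> where "\<Phi> u = sqrt (1 - u) * central_harmonic_gf u
      - 2 * (ln (1 + sqrt (1 - u)) - ln (2 * sqrt (1 - u)))" for u
  have "\<exists>c. \<forall>u\<in>ball 0 1. \<Phi> u = c"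
  proof (rule has_field_derivative_zero_constant)
    fix u :: real
    assume "u \<in> ball 0 1"
    then have u: "\<bar>u\<bar> < 1" by simp
    define s where "s = sqrt (1 - u)"
    have s: "s > 0" "1 - u = s * s"
      using u by (auto simp: s_def)
    obtain D where D: "(central_harmonic_gf has_real_derivative D) (at u)"
      and ode: "(1 - u) * D
           = central_harmonic_gf u / 2 + 1 / (sqrt (1 - u) * (1 + sqrt (1 - u)))"
      by (rule central_harmonic_gf_ode[OF u])
    have ds: "((\<lambda>u. sqrt (1 - u)) has_real_derivative (- 1 / (2 * s))) (at u)"
      using u by (auto intro!: derivative_eq_intros simp: s_def field_simps)
    have ln1: "((\<lambda>u. ln (1 + sqrt (1 - u))) has_real_derivative (- 1 / (2 * s)) / (1 + s)) (at u)"
      by (rule DERIV_cong[OF DERIV_chain2[OF DERIV_ln_divide DERIV_add[OF DERIV_const ds]]])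
        (use s(1) in \<open>simp_all add: s_def[symmetric]\<close>)
    have ln2: "((\<lambda>u. ln (2 * sqrt (1 - u))) has_real_derivative (2 * (- 1 / (2 * s))) / (2 * s)) (at u)"
      by (rule DERIV_cong[OF DERIV_chain2[OF DERIV_ln_divide DERIV_cmult[OF ds]]])
        (use s(1) in \<open>simp_all add: s_def[symmetric]\<close>)
    have "(\<Phi> has_real_derivative
        (- 1 / (2 * s)) * central_harmonic_gf u + D * s
        - 2 * ((- 1 / (2 * s)) / (1 + s) - (2 * (- 1 / (2 * s))) / (2 * s))) (at u)"
      using DERIV_diff[OF DERIV_mult[OF ds D] DERIV_cmult[OF DERIV_diff[OF ln1 ln2], of 2]]
      unfolding \<Phi>_def s_def[symmetric] .
    moreover have "(- 1 / (2 * s)) * central_harmonic_gf u + D * s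
        - 2 * ((- 1 / (2 * s)) / (1 + s) - (2 * (- 1 / (2 * s))) / (2 * s)) = 0"
    proof -
      have "D * s = (central_harmonic_gf u / 2 + 1 / (s * (1 + s))) / s"
        using ode s by (simp add: s_def[symmetric] field_simps)
      then show ?thesis
        using s(1) by (simp add: divide_simps) (simp add: algebra_simps)
    qed
    ultimately show "(\<Phi> has_real_derivative 0) (at u within ball 0 1)"
      using has_field_derivative_at_within by metis
  qed simp
  then have "\<Phi> t = \<Phi> 0"
    using assms by auto
  also have "\<Phi> 0 = 0"
    by (simp add: \<Phi>_def central_harmonic_gf_0)
  finally have "sqrt (1 - t) * central_harmonic_gf t
      = 2 * (ln (1 + sqrt (1 - t)) - ln (2 * sqrt (1 - t)))"
    by (simp add: \<Phi>_def)
  moreover have "sqrt (1 - t) > 0" "1 + sqrt (1 - t) > 0"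
    using assms by (simp_all add: add_pos_pos)
  ultimately show ?thesis
    by (simp add: ln_divide_pos field_simps)
qed

section \<open>Evaluation at the golden ratio and the Lucas numbers\<close>

lemma central_binomial_harm_sums:
  fixes x :: real
  assumes "x > 1"
  shows "(\<lambda>n. 1 / (4 ^ Suc n * x ^ Suc n) * real ((2 * Suc n) choose Suc n) * harm (Suc n))
           sums (2 * sqrt x / sqrt (x - 1) * ln ((sqrt x + sqrt (x - 1)) / (2 * sqrt (x - 1))))"
proof -
  have t: "\<bar>1 / x\<bar> < 1" using assms by simp
  have "(\<lambda>n. central_harmonic (Suc n) * (1 / x) ^ Suc n) sums central_harmonic_gf (1 / x)"
    using summable_sums[OF summable_central_harmonic[OF t]]
      sums_Suc_iff[of "\<lambda>n. central_harmonic n * (1 / x) ^ n" "central_harmonic_gf (1 / x)"]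
    by (simp add: central_harmonic_gf_def[symmetric] central_harmonic_def[of 0] harm_expand)
  moreover have "central_harmonic (Suc n) * (1 / x) ^ Suc n
      = 1 / (4 ^ Suc n * x ^ Suc n) * real ((2 * Suc n) choose Suc n) * harm (Suc n)" for n
    unfolding central_harmonic_def central_binomial_ratio_def
    by (simp only: power_one_over times_divide_eq_left times_divide_eq_right
          divide_divide_eq_left mult_1_left mult_1_right mult_ac)
  moreover have "central_harmonic_gf (1 / x)
      = 2 * sqrt x / sqrt (x - 1) * ln ((sqrt x + sqrt (x - 1)) / (2 * sqrt (x - 1)))"
  proof -
    have s: "sqrt (1 - 1 / x) = sqrt (x - 1) / sqrt x"
      using assms by (simp add: real_sqrt_divide[symmetric] field_simps)
    have "(1 + sqrt (1 - 1 / x)) / (2 * sqrt (1 - 1 / x))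
        = (sqrt x + sqrt (x - 1)) / (2 * sqrt (x - 1))"
      unfolding s using assms by (simp add: field_simps)
    then show ?thesis
      unfolding central_harmonic_gf_eq[OF t] by (simp only: s) simp
  qed
  ultimately show ?thesis by simp
qed

lemma lucas_pos: "lucas n > 0"
  by (induction n rule: lucas.induct) auto

lemma golden_ratio_gt_1: "golden_ratio > 1"
proof -
  have "sqrt 5 > sqrt 1" by (simp only: real_sqrt_less_iff)
  then show ?thesis by (simp add: golden_ratio_def)
qed

theorem theorem2p1:
  fixes r :: nat
  assumes "r \<ge> 1"
  shows "(\<lambda>n. 1 / (4 ^ Suc n * golden_ratio ^ (r * Suc n) * real (lucas r) ^ Suc n)
              * real ((2 * Suc n) choose Suc n) * (harm (Suc n) :: real))
         sums
         (2 * sqrt (golden_ratio ^ r * real (lucas r)) / sqrt (golden_ratio ^ r * real (lucas r) - 1)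
            * ln ((sqrt (golden_ratio ^ r * real (lucas r)) + sqrt (golden_ratio ^ r * real (lucas r) - 1))
                  / (2 * sqrt (golden_ratio ^ r * real (lucas r) - 1))))"
proof -
  have "1 < golden_ratio ^ r"
    using golden_ratio_gt_1 assms by (intro one_less_power) auto
  also have "\<dots> \<le> golden_ratio ^ r * real (lucas r)"
    using lucas_pos[of r] golden_ratio_gt_1 by simp
  finally have x: "1 < golden_ratio ^ r * real (lucas r)" .
  have "4 ^ Suc n * golden_ratio ^ (r * Suc n) * real (lucas r) ^ Suc n
      = 4 ^ Suc n * (golden_ratio ^ r * real (lucas r)) ^ Suc n" for n
    by (simp only: power_mult power_mult_distrib mult.assoc)
  then show ?thesis
    using central_binomial_harm_sums[OF x] by (simp only:)
qed

end
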